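(* Let $\Sigma_f$ be a rotational Ricci surface in $\mathbb{R}^3$, where $f:I\to\mathbb{R}$ is a positive smooth function on an open interval $I\subseteq\mathbb{R}$ defined by $$f(s)=\sqrt{bs^2+2cs+d}$$ for some $b,c,d\in\mathbb{R}$. Suppose that the Gaussian curvature $K$ of $\Sigma_f$ does not vanish and, when $b\neq 0$ and $(bd-c^2)(b-1)>0$, set $$s_1=-\frac1b\left(c+\sqrt{\frac{bd-c^2}{b-1}}\right),\qquad s_2=-\frac1b\left(c-\sqrt{\frac{bd-c^2}{b-1}}\right).$$ Then one of the following holds. 1. If $K<0$, then $b,d\in(0,+\infty)$, $c^2<bd$ and - either $I\subseteq\mathbb{R}$ for $0<b\le 1$; - or $I\subseteq(s_1,s_2)$ for $b>1$. 2. If $K>0$, then $b\in(-\infty,1)$, $bd<c^2$ and - either $I\subseteq(s_2,s_1)$ for $b<0$; - or $I\subseteq\left(\frac{c^2-d}{2c},+\infty\right)$ if $c>0$, or $I\subseteq\left(-\infty,\frac{c^2-d}{2c}\right)$ if $c<0$, for $b=0$; - or $I\subseteq(-\infty,s_1)$ or $I\subseteq(s_2,+\infty)$ for $0<b<1$.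
   Context: Rotational surfaces: let $I\subseteq\mathbb{R}$ be an open interval, and let $f,g:I\to\mathbb{R}$ be smooth with $f>0$, $(f')^2+(g')^2=1$ and $g'\ge 0$. The rotational surface $\Sigma_f\subset\mathbb{R}^3$ is the surface parametrised by $X(s,\theta)=(f(s)\cos\theta,f(s)\sin\theta,g(s))$; its profile curve is $\alpha(s)=(f(s),0,g(s))$, parametrised by arc length. In particular $|f'|\le 1$, and, up to a vertical isometry of $\mathbb{R}^3$, $g(s)=\int_{s_0}^s\sqrt{1-f'(\zeta)^2}\,d\zeta$ with $s_0\in I$, so $\Sigma_f$ is determined by $f$. The induced metric is $ds^2+f(s)^2d\theta^2$ and the Gaussian curvature is $K=-f''/f$. A rotational Ricci surface is a rotational surface $\Sigma_f$ whose Gaussian curvature satisfies the Ricci condition $K\Delta K-\|\nabla K\|^2-4K^3=0$, equivalently $KK''-(K')^2-4K^3+\frac{f'}{f}KK'=0$ with $K=-f''/f$. *)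

theory Defs
  imports "HOL-Analysis.Analysis"
begin

text \<open>Infinite differentiability of a real function on an open set. Functions on an interval are
  total functions here; only their values on the open set matter.\<close>

definition smooth_on :: "real set \<Rightarrow> (real \<Rightarrow> real) \<Rightarrow> bool" where
  "smooth_on I f \<longleftrightarrow> (\<forall>n. \<forall>s\<in>I. ((deriv ^^ n) f) differentiable (at s))"

text \<open>A parametrisation is a curried function of two real parameters \<open>(u, v)\<close>.\<close>

definition D1 :: "(real \<Rightarrow> real \<Rightarrow> 'a::real_normed_vector) \<Rightarrow> real \<Rightarrow> real \<Rightarrow> 'a" where
  "D1 X u v = vector_derivative (\<lambda>x. X x v) (at u)"

definition D2 :: "(real \<Rightarrow> real \<Rightarrow> 'a::real_normed_vector) \<Rightarrow> real \<Rightarrow> real \<Rightarrow> 'a" where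
  "D2 X u v = vector_derivative (\<lambda>y. X u y) (at v)"

type_synonym param = "real \<Rightarrow> real \<Rightarrow> real ^ 3"

definition ffE :: "param \<Rightarrow> real \<Rightarrow> real \<Rightarrow> real" where
  "ffE X u v = D1 X u v \<bullet> D1 X u v"

definition ffF :: "param \<Rightarrow> real \<Rightarrow> real \<Rightarrow> real" where
  "ffF X u v = D1 X u v \<bullet> D2 X u v"

definition ffG :: "param \<Rightarrow> real \<Rightarrow> real \<Rightarrow> real" where
  "ffG X u v = D2 X u v \<bullet> D2 X u v"

definition ff_det :: "param \<Rightarrow> real \<Rightarrow> real \<Rightarrow> real" where
  "ff_det X u v = ffE X u v * ffG X u v - (ffF X u v)\<^sup>2"

definition unit_normal :: "param \<Rightarrow> real \<Rightarrow> real \<Rightarrow> real ^ 3" where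
  "unit_normal X u v = sgn (cross3 (D1 X u v) (D2 X u v))"

definition sfL :: "param \<Rightarrow> real \<Rightarrow> real \<Rightarrow> real" where
  "sfL X u v = D1 (D1 X) u v \<bullet> unit_normal X u v"

definition sfM :: "param \<Rightarrow> real \<Rightarrow> real \<Rightarrow> real" where
  "sfM X u v = D2 (D1 X) u v \<bullet> unit_normal X u v"

definition sfN :: "param \<Rightarrow> real \<Rightarrow> real \<Rightarrow> real" where
  "sfN X u v = D2 (D2 X) u v \<bullet> unit_normal X u v"

definition gauss_curvature :: "param \<Rightarrow> real \<Rightarrow> real \<Rightarrow> real" where
  "gauss_curvature X u v = (sfL X u v * sfN X u v - (sfM X u v)\<^sup>2) / ff_det X u v"

text \<open>Squared norm of the gradient and Laplace-Beltrami operator (\<open>div grad\<close>) of the induced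
  metric, in local coordinates: \<open>g\<^sup>i\<^sup>j h\<^sub>i h\<^sub>j\<close> and \<open>W\<^sup>-\<^sup>1 (W g\<^sup>i\<^sup>j h\<^sub>j)\<^sub>i\<close> with \<open>W = sqrt (E G - F\<^sup>2)\<close>.\<close>

definition grad_norm_sq :: "param \<Rightarrow> (real \<Rightarrow> real \<Rightarrow> real) \<Rightarrow> real \<Rightarrow> real \<Rightarrow> real" where
  "grad_norm_sq X h u v =
     (ffG X u v * (D1 h u v)\<^sup>2 - 2 * ffF X u v * D1 h u v * D2 h u v + ffE X u v * (D2 h u v)\<^sup>2)
       / ff_det X u v"

definition laplace_beltrami :: "param \<Rightarrow> (real \<Rightarrow> real \<Rightarrow> real) \<Rightarrow> real \<Rightarrow> real \<Rightarrow> real" where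
  "laplace_beltrami X h u v =
     (D1 (\<lambda>x y. (ffG X x y * D1 h x y - ffF X x y * D2 h x y) / sqrt (ff_det X x y)) u v
      + D2 (\<lambda>x y. (ffE X x y * D2 h x y - ffF X x y * D1 h x y) / sqrt (ff_det X x y)) u v)
       / sqrt (ff_det X u v)"

definition ricci_condition :: "param \<Rightarrow> real \<Rightarrow> real \<Rightarrow> bool" where
  "ricci_condition X u v \<longleftrightarrow>
     gauss_curvature X u v * laplace_beltrami X (gauss_curvature X) u v
       - grad_norm_sq X (gauss_curvature X) u v - 4 * (gauss_curvature X u v) ^ 3 = 0"

definition rot_param :: "(real \<Rightarrow> real) \<Rightarrow> (real \<Rightarrow> real) \<Rightarrow> param" where
  "rot_param f g s \<theta> = vector [f s * cos \<theta>, f s * sin \<theta>, g s]"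

definition rotational_surface :: "real set \<Rightarrow> (real \<Rightarrow> real) \<Rightarrow> (real \<Rightarrow> real) \<Rightarrow> bool" where
  "rotational_surface I f g \<longleftrightarrow>
     open I \<and> is_interval I \<and> I \<noteq> {} \<and> smooth_on I f \<and> smooth_on I g \<and>
     (\<forall>s\<in>I. f s > 0 \<and> (deriv f s)\<^sup>2 + (deriv g s)\<^sup>2 = 1 \<and> deriv g s \<ge> 0)"

definition rotational_ricci_surface :: "real set \<Rightarrow> (real \<Rightarrow> real) \<Rightarrow> (real \<Rightarrow> real) \<Rightarrow> bool" where
  "rotational_ricci_surface I f g \<longleftrightarrow>
     rotational_surface I f g \<and> (\<forall>s\<in>I. \<forall>\<theta>. ricci_condition (rot_param f g) s \<theta>)"

end

theory Submission
  imports Defs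
begin

text \<open>With \<open>D = b d - c\<^sup>2\<close> and \<open>f\<^sup>2 = q = b s\<^sup>2 + 2 c s + d\<close>, one has \<open>f' = (b s + c) / f\<close>,
  \<open>f'' = D / f\<^sup>3\<close> and \<open>K = - D / q\<^sup>2\<close>, so \<open>K\<close> has the constant sign of \<open>- D\<close>. Differentiating
  \<open>f'\<^sup>2 + g'\<^sup>2 = 1\<close> gives \<open>f' f'' = - g' g''\<close>; as \<open>f'' \<noteq> 0\<close>, this excludes \<open>g' = 0\<close>, hence
  \<open>(b s + c)\<^sup>2 < q\<close> on \<open>I\<close>. Multiplied by \<open>b\<close>, this compares \<open>(b - 1) (b s + c)\<^sup>2\<close> with \<open>D\<close>, and the
  cases are those of the signs of \<open>D\<close>, \<open>b\<close> and \<open>b - 1\<close>; for \<open>b = 0\<close> it is linear in \<open>s\<close>.\<close>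

section \<open>Derivatives of curves in \<open>real^3\<close> and of smooth functions\<close>

lemma vector_3_eq_scaleR:
  "(vector [x, y, z] :: real^3) =
     x *\<^sub>R vector [1, 0, 0] + y *\<^sub>R vector [0, 1, 0] + z *\<^sub>R vector [0, 0, 1]"
  by (simp add: vec_eq_iff forall_3)

text \<open>Splitting along the standard basis reduces the claim to the rules for sums and for
  scalar multiples of fixed vectors.\<close>

lemma has_vector_derivative_vector_3:
  assumes "(x has_real_derivative x') (at t)" "(y has_real_derivative y') (at t)"
    "(z has_real_derivative z') (at t)"
  shows "((\<lambda>t. vector [x t, y t, z t] :: real^3) has_vector_derivative vector [x', y', z']) (at t)"
proof -
  have "((\<lambda>t. x t *\<^sub>R vector [1, 0, 0] + y t *\<^sub>R vector [0, 1, 0] + z t *\<^sub>R (vector [0, 0, 1] :: real^3))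
     has_vector_derivative
       x' *\<^sub>R vector [1, 0, 0] + y' *\<^sub>R vector [0, 1, 0] + z' *\<^sub>R vector [0, 0, 1]) (at t)"
    using assms by (auto intro!: derivative_eq_intros)
  then show ?thesis
    by (subst (1 2) vector_3_eq_scaleR)
qed

text \<open>Derivatives depend only on values near the point. This serves second partial
  derivatives: the closed form of \<open>D1 X\<close> holds only for parameters in \<open>I\<close>,
  so it may be differentiated because \<open>I\<close> is open.\<close>

lemma vector_derivative_cong_open:
  assumes "open S" "t \<in> S" "\<And>x. x \<in> S \<Longrightarrow> F x = G x"
    and "(G has_vector_derivative D) (at t)"
  shows "vector_derivative F (at t) = D"
proof -
  have "(F has_vector_derivative D) (at t)"
    by (rule has_vector_derivative_transform_within_open[OF assms(4,1,2)]) (simp add: assms(3))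
  then show ?thesis by (rule vector_derivative_at)
qed

lemma smooth_on_DERIV:
  assumes "smooth_on I f" "s \<in> I"
  shows "(f has_real_derivative deriv f s) (at s)"
    and "(deriv f has_real_derivative deriv (deriv f) s) (at s)"
proof -
  have "(deriv ^^ 0) f differentiable (at s)" "(deriv ^^ 1) f differentiable (at s)"
    using assms unfolding smooth_on_def by blast+
  then show "(f has_real_derivative deriv f s) (at s)"
    and "(deriv f has_real_derivative deriv (deriv f) s) (at s)"
    by (auto intro: DERIV_deriv_iff_real_differentiable[THEN iffD2])
qed

section \<open>Unit speed and the Gaussian curvature of a rotational surface\<close>

lemma rotational_surface_deriv_deriv:
  assumes "rotational_surface I f g" "s \<in> I"
  shows "deriv f s * deriv (deriv f) s + deriv g s * deriv (deriv g) s = 0"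
proof -
  have I: "open I" "smooth_on I f" "smooth_on I g"
    and unit: "\<And>t. t \<in> I \<Longrightarrow> (deriv f t)\<^sup>2 + (deriv g t)\<^sup>2 = 1"
    using assms(1) by (auto simp: rotational_surface_def)
  have "((\<lambda>t. (deriv f t)\<^sup>2 + (deriv g t)\<^sup>2) has_real_derivative
      2 * (deriv f s * deriv (deriv f) s + deriv g s * deriv (deriv g) s)) (at s)"
    using smooth_on_DERIV(2)[OF I(2) assms(2)] smooth_on_DERIV(2)[OF I(3) assms(2)]
    by (auto intro!: derivative_eq_intros simp: algebra_simps)
  moreover have "((\<lambda>t. (deriv f t)\<^sup>2 + (deriv g t)\<^sup>2) has_real_derivative 0) (at s)"
    by (rule has_field_derivative_transform_within_open[OF DERIV_const[of 1] I(1) assms(2)])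
      (simp add: unit)
  ultimately show ?thesis
    using DERIV_unique by fastforce
qed

text \<open>The coordinate curves are lines of curvature: \<open>F = M = 0\<close>, with
  \<open>E = 1\<close> and \<open>G\<close> the square of \<open>f\<close>. So the curvature is
  \<open>L N / G\<close>, and the unit speed relation and its derivative eliminate
  \<open>g\<close>.\<close>

lemma gauss_curvature_rot_param:
  assumes "rotational_surface I f g" "s \<in> I"
  shows "gauss_curvature (rot_param f g) s \<theta> = - deriv (deriv f) s / f s"
proof -
  let ?X = "rot_param f g"
  have I: "open I" "smooth_on I f" "smooth_on I g"
    and unit: "(deriv f s)\<^sup>2 + (deriv g s)\<^sup>2 = 1" and pos: "f s > 0"
    using assms by (auto simp: rotational_surface_def)
  note df = smooth_on_DERIV[OF I(2)] and dg = smooth_on_DERIV[OF I(3)]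
  have X1: "D1 ?X t v = vector [deriv f t * cos v, deriv f t * sin v, deriv g t]" if "t \<in> I" for t v
    unfolding D1_def rot_param_def using df(1)[OF that] dg(1)[OF that]
    by (intro vector_derivative_at has_vector_derivative_vector_3) (auto intro!: derivative_eq_intros)
  have X2: "D2 ?X t v = vector [- f t * sin v, f t * cos v, 0]" for t v
    unfolding D2_def rot_param_def
    by (intro vector_derivative_at has_vector_derivative_vector_3) (auto intro!: derivative_eq_intros)
  have X11: "D1 (D1 ?X) s \<theta> =
      vector [deriv (deriv f) s * cos \<theta>, deriv (deriv f) s * sin \<theta>, deriv (deriv g) s]"
    unfolding D1_def[of "D1 ?X"]
    by (rule vector_derivative_cong_open[OF I(1) assms(2) X1], assumption,
        intro has_vector_derivative_vector_3)
      (use df(2)[OF assms(2)] dg(2)[OF assms(2)] in \<open>auto intro!: derivative_eq_intros\<close>)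
  have X12: "D2 (D1 ?X) s \<theta> = vector [- deriv f s * sin \<theta>, deriv f s * cos \<theta>, 0]"
    unfolding D2_def[of "D1 ?X"] X1[OF assms(2)]
    by (intro vector_derivative_at has_vector_derivative_vector_3) (auto intro!: derivative_eq_intros)
  have X22: "D2 (D2 ?X) s \<theta> = vector [- f s * cos \<theta>, - f s * sin \<theta>, 0]"
    unfolding D2_def[of "D2 ?X"] X2
    by (intro vector_derivative_at has_vector_derivative_vector_3) (auto intro!: derivative_eq_intros)
  have trig: "(cos \<theta>)\<^sup>2 = 1 - (sin \<theta>)\<^sup>2"
    by (simp add: cos_squared_eq)
  have E: "ffE ?X s \<theta> = 1"
    using unit trig by (simp add: ffE_def X1[OF assms(2)] inner_vec_def sum_3 power2_eq_square)
      algebra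
  have F: "ffF ?X s \<theta> = 0"
    by (simp add: ffF_def X1[OF assms(2)] X2 inner_vec_def sum_3)
  have G: "ffG ?X s \<theta> = (f s)\<^sup>2"
    using trig by (simp add: ffG_def X2 inner_vec_def sum_3 power2_eq_square) algebra
  \<comment> \<open>This is the cross product of the two partial derivatives divided by
    \<open>f s\<close>; as \<open>f s > 0\<close>, normalising leaves no sign ambiguity.\<close>
  define n :: "real^3" where "n = vector [- deriv g s * cos \<theta>, - deriv g s * sin \<theta>, deriv f s]"
  have "n \<bullet> n = 1"
    using unit trig by (simp add: n_def inner_vec_def sum_3 power2_eq_square) algebra
  then have norm_n: "norm n = 1"
    by (simp add: norm_eq_1)
  have "cross3 (D1 ?X s \<theta>) (D2 ?X s \<theta>) = f s *\<^sub>R n"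
    using trig by (simp add: X1[OF assms(2)] X2 n_def cross3_def vec_eq_iff forall_3
        power2_eq_square) algebra
  then have N: "unit_normal ?X s \<theta> = n"
    using pos norm_n by (simp add: unit_normal_def sgn_scaleR sgn_div_norm[of n])
  have L: "sfL ?X s \<theta> = deriv f s * deriv (deriv g) s - deriv (deriv f) s * deriv g s"
    using trig by (simp add: sfL_def X11 N n_def inner_vec_def sum_3 power2_eq_square) algebra
  have M: "sfM ?X s \<theta> = 0"
    by (simp add: sfM_def X12 N n_def inner_vec_def sum_3)
  have N': "sfN ?X s \<theta> = f s * deriv g s"
    using trig by (simp add: sfN_def X22 N n_def inner_vec_def sum_3 power2_eq_square) algebra
  \<comment> \<open>The factor g' comes from \<open>N\<close>. It lets g' g'' be replaced by - f'
    f'', after which the unit speed relation leaves - f''. Nothing is divided by g', so points with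
    g' = 0 are covered.\<close>
  have "(deriv f s * deriv (deriv g) s - deriv (deriv f) s * deriv g s) * deriv g s
      = - deriv (deriv f) s"
    using rotational_surface_deriv_deriv[OF assms] unit by algebra
  then have "(deriv f s * deriv (deriv g) s - deriv (deriv f) s * deriv g s) * (f s * deriv g s)
      = - deriv (deriv f) s * f s"
    by algebra
  then show ?thesis
    using pos by (simp add: gauss_curvature_def ff_det_def E F G L M N' power2_eq_square)
qed

section \<open>Derivatives of the square root of a quadratic\<close>

lemma deriv_sqrt_quadratic:
  fixes f :: "real \<Rightarrow> real"
  assumes "open I" "s \<in> I" and f: "\<And>t. t \<in> I \<Longrightarrow> f t = sqrt (b * t\<^sup>2 + 2 * c * t + d)"
    and pos: "\<And>t. t \<in> I \<Longrightarrow> f t > 0"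
  shows "deriv f s = (b * s + c) / f s"
    and "deriv (deriv f) s = (b * d - c\<^sup>2) / (f s) ^ 3"
proof -
  \<comment> \<open>The real \<open>sqrt\<close> is negative at negative arguments, so
    \<open>f t > 0\<close> forces a positive radicand.\<close>
  have sq: "b * t\<^sup>2 + 2 * c * t + d = (f t)\<^sup>2" if "t \<in> I" for t
    using f[OF that] pos[OF that] by auto
  have D: "(f has_real_derivative (b * t + c) / f t) (at t)" if "t \<in> I" for t
  proof (rule has_field_derivative_transform_within_open[OF _ assms(1) that f[symmetric]])
    have "b * t\<^sup>2 + 2 * c * t + d > 0"
      using sq[OF that] pos[OF that] by simp
    then show "((\<lambda>t. sqrt (b * t\<^sup>2 + 2 * c * t + d)) has_real_derivative (b * t + c) / f t) (at t)"
      unfolding f[OF that] by (auto intro!: derivative_eq_intros simp: field_simps)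
  qed
  show "deriv f s = (b * s + c) / f s"
    by (rule DERIV_imp_deriv[OF D[OF assms(2)]])
  have nz: "f s \<noteq> 0" using pos[OF assms(2)] by simp
  have "((\<lambda>t. (b * t + c) / f t) has_real_derivative (b * d - c\<^sup>2) / (f s) ^ 3) (at s)"
  proof -
    have "(b * f s - (b * s + c) * ((b * s + c) / f s)) / (f s * f s) = (b * d - c\<^sup>2) / (f s) ^ 3"
    proof -
      \<comment> \<open>Completing the square: the numerator of the quotient rule does not depend on
        \<open>s\<close>.\<close>
      have "b * (f s)\<^sup>2 - (b * s + c)\<^sup>2 = b * d - c\<^sup>2"
        unfolding sq[OF assms(2), symmetric] by algebra
      then show ?thesis
        using nz by (simp add: divide_simps power2_eq_square power3_eq_cube)
    qed
    then show ?thesis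
      using D[OF assms(2)] nz by (auto intro!: derivative_eq_intros)
  qed
  then have "(deriv f has_real_derivative (b * d - c\<^sup>2) / (f s) ^ 3) (at s)"
    by (rule has_field_derivative_transform_within_open[OF _ assms(1,2)])
      (rule DERIV_imp_deriv[OF D, symmetric])
  then show "deriv (deriv f) s = (b * d - c\<^sup>2) / (f s) ^ 3"
    by (rule DERIV_imp_deriv)
qed

section \<open>Case analysis by the signs of \<open>D\<close>, \<open>b\<close> and
  \<open>b - 1\<close>\<close>

theorem theorem3p2:
  fixes I :: "real set" and f g :: "real \<Rightarrow> real" and b c d s1 s2 :: real
    and K :: "real \<Rightarrow> real \<Rightarrow> real"
  defines "K \<equiv> gauss_curvature (rot_param f g)"
  assumes "rotational_ricci_surface I f g"
    and "\<forall>s\<in>I. f s = sqrt (b * s\<^sup>2 + 2 * c * s + d)"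
    and "\<forall>s\<in>I. \<forall>\<theta>. K s \<theta> \<noteq> 0"
    and "b \<noteq> 0 \<and> (b * d - c\<^sup>2) * (b - 1) > 0 \<longrightarrow>
           s1 = - (1 / b) * (c + sqrt ((b * d - c\<^sup>2) / (b - 1))) \<and>
           s2 = - (1 / b) * (c - sqrt ((b * d - c\<^sup>2) / (b - 1)))"
  shows "((\<forall>s\<in>I. \<forall>\<theta>. K s \<theta> < 0) \<and>
            b \<in> {0<..} \<and> d \<in> {0<..} \<and> c\<^sup>2 < b * d \<and>
            ((0 < b \<and> b \<le> 1 \<and> I \<subseteq> UNIV) \<or>
             (b > 1 \<and> I \<subseteq> {s1<..<s2})))
       \<or> ((\<forall>s\<in>I. \<forall>\<theta>. K s \<theta> > 0) \<and>
            b \<in> {..<1} \<and> b * d < c\<^sup>2 \<and>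
            ((b < 0 \<and> I \<subseteq> {s2<..<s1}) \<or>
             (b = 0 \<and> ((c > 0 \<and> I \<subseteq> {(c\<^sup>2 - d) / (2 * c)<..}) \<or>
                       (c < 0 \<and> I \<subseteq> {..<(c\<^sup>2 - d) / (2 * c)}))) \<or>
             (0 < b \<and> b < 1 \<and> (I \<subseteq> {..<s1} \<or> I \<subseteq> {s2<..}))))"
proof -
  have surf: "rotational_surface I f g"
    using assms(2) by (simp add: rotational_ricci_surface_def)
  then have I: "open I" "is_interval I" "I \<noteq> {}"
    and pos: "\<And>s. s \<in> I \<Longrightarrow> f s > 0"
    and unit: "\<And>s. s \<in> I \<Longrightarrow> (deriv f s)\<^sup>2 + (deriv g s)\<^sup>2 = 1"
    by (auto simp: rotational_surface_def)
  have f: "\<And>s. s \<in> I \<Longrightarrow> f s = sqrt (b * s\<^sup>2 + 2 * c * s + d)"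
    using assms(3) by blast
  note df = deriv_sqrt_quadratic[OF I(1) _ f pos]
  define D where "D = b * d - c\<^sup>2"
  have q: "b * s\<^sup>2 + 2 * c * s + d > 0" and fsq: "(f s)\<^sup>2 = b * s\<^sup>2 + 2 * c * s + d"
    if "s \<in> I" for s
    using f[OF that] pos[OF that] by auto
  have K: "K s \<theta> = - D / (f s) ^ 4" if "s \<in> I" for s \<theta>
    unfolding K_def gauss_curvature_rot_param[OF surf that]
    using df(2)[OF that, folded D_def] by (simp add: power4_eq_xxxx power3_eq_cube)
  \<comment> \<open>\<open>b\<close> and \<open>D\<close> are constants, so their signs can be read
    off at a single point.\<close>
  obtain s0 where s0: "s0 \<in> I" using I(3) by blast
  have D_nz: "D \<noteq> 0"
    using assms(4) K[OF s0, of 0] s0 by auto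
  have slope: "(b * s + c)\<^sup>2 < b * s\<^sup>2 + 2 * c * s + d" if s: "s \<in> I" for s
  proof -
    have "deriv g s \<noteq> 0"
    proof
      assume "deriv g s = 0"
      then have "deriv f s * deriv (deriv f) s = 0" "deriv f s \<noteq> 0"
        using rotational_surface_deriv_deriv[OF surf s] unit[OF s] by auto
      then show False
        using df(2)[OF s] pos[OF s] D_nz by (simp add: D_def)
    qed
    then have "(deriv f s)\<^sup>2 < 1"
      using unit[OF s] by (smt (verit) zero_less_power2)
    then show ?thesis
      using q[OF s] fsq[OF s] df(1)[OF s] by (simp add: power_divide)
  qed
  \<comment> \<open>\<open>bq\<close> completes the square; subtracting
    \<open>b * (b * s + c)\<^sup>2\<close> turns it into \<open>h\<close>, whose left side has the
    sign of \<open>b\<close> on \<open>I\<close> by \<open>slope\<close>.\<close>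
  have h: "b * (b * s\<^sup>2 + 2 * c * s + d - (b * s + c)\<^sup>2) = D - (b - 1) * (b * s + c)\<^sup>2"
    and bq: "b * (b * s\<^sup>2 + 2 * c * s + d) = (b * s + c)\<^sup>2 + D" for s
    unfolding D_def by algebra+
  define r where "r = sqrt (D / (b - 1))"
  \<comment> \<open>\<open>s1\<close> and \<open>s2\<close> are the zeros of the right side of
    \<open>h\<close>, where \<open>b * s + c\<close> equals \<open>- r\<close> or \<open>r\<close>.
    Keeping the factor \<open>b\<close> gives one form for both signs of \<open>b\<close>; the order
    of the endpoints is settled when \<open>b\<close> is cancelled.\<close>
  have ends: "b * s1 = - c - r" "b * s2 = - c + r" "r > 0" "r\<^sup>2 * (b - 1) = D"
    if "b \<noteq> 0" "D * (b - 1) > 0"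
  proof -
    have "s1 = - (1 / b) * (c + r)" "s2 = - (1 / b) * (c - r)"
      using assms(5) that by (auto simp: D_def r_def)
    then show "b * s1 = - c - r" "b * s2 = - c + r"
      using that(1) by auto
    have "D / (b - 1) > 0"
      using that(2) by (simp add: zero_less_divide_iff zero_less_mult_iff)
    then show "r > 0" "r\<^sup>2 * (b - 1) = D"
      by (auto simp: r_def)
  qed
  show ?thesis
  proof (cases "D > 0")
    case True
    \<comment> \<open>By \<open>bq\<close>, \<open>b\<close> times a positive number is a square
      plus \<open>D\<close>, hence positive.\<close>
    have b: "b > 0"
      using q[OF s0] bq[of s0] True by (smt (verit) zero_less_mult_pos2 zero_le_power2)
    have lt: "c\<^sup>2 < b * d" using True by (simp add: D_def)
    then have d: "d > 0" using b by (smt (verit) zero_less_mult_pos zero_le_power2)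
    have "I \<subseteq> {s1<..<s2}" if "b > 1"
    proof
      fix s assume s: "s \<in> I"
      have e: "b * s1 = - c - r" "b * s2 = - c + r" "r > 0" "r\<^sup>2 * (b - 1) = D"
        using ends that True by auto
      have "D - (b - 1) * (b * s + c)\<^sup>2 > 0"
        unfolding h[symmetric] using b slope[OF s] by simp
      then have "(b - 1) * (b * s + c)\<^sup>2 < (b - 1) * r\<^sup>2"
        using e(4) by (simp add: mult.commute)
      then have "(b * s + c)\<^sup>2 < r\<^sup>2" using that by simp
      then have "\<bar>b * s + c\<bar> < r" using e(3) power_less_imp_less_base[of "\<bar>b * s + c\<bar>" 2 r] by simp
      then have "b * s1 < b * s" "b * s < b * s2" using e by auto
      then show "s \<in> {s1<..<s2}" using b by simp
    qed
    moreover have "\<forall>s\<in>I. \<forall>\<theta>. K s \<theta> < 0"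
      using True by (simp add: K zero_less_divide_iff less_imp_neq[OF pos, symmetric])
    ultimately show ?thesis
      using b d lt by (cases "b \<le> 1") simp_all
  next
    case False
    then have D: "D < 0" using D_nz by simp
    have h_pos: "b * s\<^sup>2 + 2 * c * s + d - (b * s + c)\<^sup>2 > 0" if "s \<in> I" for s
      using slope[OF that] by simp
    have b: "b < 1"
    \<comment> \<open>For \<open>b \<ge> 1\<close> the left side of \<open>h\<close> would be
      positive, while its right side is at most \<open>D < 0\<close>.\<close>
    proof (rule ccontr)
      assume "\<not> b < 1"
      then have "D - (b - 1) * (b * s0 + c)\<^sup>2 > 0" "(b - 1) * (b * s0 + c)\<^sup>2 \<ge> 0"
        unfolding h[symmetric] using h_pos[OF s0] by auto
      then show False using D by simp
    qed
    have Db: "D * (b - 1) > 0" using D b by (simp add: mult_neg_neg)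
    have "I \<subseteq> {s2<..<s1}" if "b < 0"
    proof
      fix s assume s: "s \<in> I"
      note e = ends[OF less_imp_neq[OF that] Db]
      \<comment> \<open>Multiplying by \<open>b < 0\<close> reverses \<open>slope\<close>, and
        cancelling \<open>b - 1 < 0\<close> reverses it again. So \<open>s\<close> lies between the
        zeros, and the last division by \<open>b\<close> puts \<open>s2\<close> on the left.\<close>
      have "D - (b - 1) * (b * s + c)\<^sup>2 < 0"
        unfolding h[symmetric] using that h_pos[OF s] by (rule mult_neg_pos)
      then have "(b - 1) * r\<^sup>2 < (b - 1) * (b * s + c)\<^sup>2"
        using e(4) by (simp add: mult.commute)
      then have "(b * s + c)\<^sup>2 < r\<^sup>2" using b by simp
      then have "\<bar>b * s + c\<bar> < r" using e(3) power_less_imp_less_base[of "\<bar>b * s + c\<bar>" 2 r] by simp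
      then have "b * s1 < b * s" "b * s < b * s2" using e by auto
      then show "s \<in> {s2<..<s1}" using that by simp
    qed
    moreover have "(c > 0 \<and> I \<subseteq> {(c\<^sup>2 - d) / (2 * c)<..}) \<or> (c < 0 \<and> I \<subseteq> {..<(c\<^sup>2 - d) / (2 * c)})"
      if "b = 0"
    proof -
      \<comment> \<open>Here \<open>D\<close> is \<open>- c\<^sup>2\<close>, and
        \<open>slope\<close> becomes linear in \<open>s\<close>; dividing by \<open>2 * c\<close>
        gives a half-line on the side fixed by the sign of \<open>c\<close>.\<close>
      have "c \<noteq> 0" using D that by (auto simp: D_def)
      moreover have "c\<^sup>2 - d < 2 * c * s" if "s \<in> I" for s
        using slope[OF that] \<open>b = 0\<close> by simp
      ultimately show ?thesis
        by (cases "c > 0") (auto simp: field_simps)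
    qed
    moreover have "I \<subseteq> {..<s1} \<or> I \<subseteq> {s2<..}" if "b > 0"
    proof -
      note e = ends[OF less_imp_neq[OF that, symmetric] Db]
      have "b * s1 < b * s2" using e by simp
      then have le: "s1 < s2" using that by simp
      \<comment> \<open>Only \<open>b - 1 < 0\<close> reverses the inequality now, so
        \<open>s\<close> lies outside the closed interval between the zeros.\<close>
      have out: "s < s1 \<or> s2 < s" if s: "s \<in> I" for s
      proof -
        have "D - (b - 1) * (b * s + c)\<^sup>2 > 0"
          unfolding h[symmetric] using \<open>b > 0\<close> h_pos[OF s] by (rule mult_pos_pos)
        then have "(b - 1) * (b * s + c)\<^sup>2 < (b - 1) * r\<^sup>2"
          using e(4) by (simp add: mult.commute)
        then have "r\<^sup>2 < (b * s + c)\<^sup>2" using b by simp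
        then have "r < \<bar>b * s + c\<bar>" using power_less_imp_less_base[of r 2 "\<bar>b * s + c\<bar>"] by simp
        then have "b * s < b * s1 \<or> b * s2 < b * s" using e by auto
        then show ?thesis using \<open>b > 0\<close> by simp
      qed
      show ?thesis
      proof (rule ccontr)
        \<comment> \<open>Failure of both inclusions gives points of \<open>I\<close> beyond each
          zero; the interval \<open>I\<close> then contains \<open>s1\<close>, contrary to
          \<open>out\<close>.\<close>
        assume "\<not> ?thesis"
        then obtain x y where "x \<in> I" "y \<in> I" "s2 < x" "y < s1"
          using out by (fastforce simp: not_less)
        then have "s1 \<in> I"
          using I(2) le unfolding is_interval_1 by (meson less_imp_le less_trans)
        then show False using out le by fastforce
      qed
    qed
    moreover have "\<forall>s\<in>I. \<forall>\<theta>. K s \<theta> > 0"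
      using D by (simp add: K divide_less_0_iff less_imp_neq[OF pos, symmetric])
    moreover have "b * d < c\<^sup>2" using D by (simp add: D_def)
    ultimately show ?thesis
      using b by (cases b "0 :: real" rule: linorder_cases) simp_all
  qed
qed

end
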